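(* Let $S(t)$, $t\in\mathbb{N}_0$, be the simple symmetric random walk on $\mathbb{Z}$ with $S(0)=0$, and let $Z(t)=S(t)+i\widetilde S(t)$, $t\in\mathbb{N}_0$, be its complexification. Then Fujita's polynomial martingales $(m_n(t,S(t)))_{t\in\mathbb{N}_0}$, $n\in\mathbb{N}_0$, have the representations $$m_n(t,S(t))=\widetilde{\mathrm{E}}[Z(t)^n],\qquad n\in\mathbb{N}_0,\ t\in\mathbb{N}_0.$$
   Context: $\mathbb{N}_0=\{0,1,2,\dots\}$. Fujita's polynomials $m_n(t,x)$, $n\in\mathbb{N}_0$, are defined by the expansion around $\alpha=0$ $$\frac{e^{\alpha x}}{(\cosh\alpha)^t}=\sum_{n=0}^\infty m_n(t,x)\frac{\alpha^n}{n!},\qquad t\in\mathbb{N}_0,\ x\in\mathbb{Z};$$ $m_n(t,\cdot)$ is a monic polynomial of degree $n$. The process $\widetilde S$ is independent of $S$, with $\widetilde S(0)=0$ and $\widetilde S(t)=\widetilde\zeta(1)+\cdots+\widetilde\zeta(t)$, where $\widetilde\zeta(1),\widetilde\zeta(2),\dots$ are i.i.d. real random variables with the hyperbolic secant density $\frac{1}{2\cosh(\pi x/2)}$. $\widetilde{\mathrm{E}}$ denotes expectation with respect to $\widetilde S$ only (with $S$ kept fixed). *)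

theory Defs
  imports "HOL-Probability.Probability"
begin

definition fujita_gen :: "nat \<Rightarrow> int \<Rightarrow> real \<Rightarrow> real" where
  "fujita_gen t x \<alpha> = exp (\<alpha> * real_of_int x) / cosh \<alpha> ^ t"

definition fujita_poly :: "nat \<Rightarrow> nat \<Rightarrow> int \<Rightarrow> real" where
  "fujita_poly n t x = fact n * fps_nth (THE F. fujita_gen t x has_fps_expansion F) n"

lemma fps_nth_has_fps_expansion_real:
  fixes f :: "real \<Rightarrow> real"
  assumes "f has_fps_expansion F"
  shows "fps_nth F n = (deriv ^^ n) f 0 / fact n"
  using assms
proof (induction n arbitrary: f F)
  case 0
  then show ?case
    by (auto simp: has_fps_expansion_def eval_fps_at_0 dest: eventually_nhds_x_imp_x)
next
  case (Suc n)
  have "fps_nth (fps_deriv F) n = (deriv ^^ n) (deriv f) 0 / fact n"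
    by (intro Suc.IH has_fps_expansion_deriv Suc.prems)
  then have "real (Suc n) * fps_nth F (Suc n) = (deriv ^^ Suc n) f 0 / fact n"
    by (simp add: funpow_Suc_right del: funpow.simps of_nat_Suc)
  then have "fps_nth F (Suc n) = (deriv ^^ Suc n) f 0 / fact n / real (Suc n)"
    by (metis nonzero_mult_div_cancel_left of_nat_neq_0)
  then show ?case
    by (simp add: mult.commute del: funpow.simps of_nat_Suc)
qed

lemma has_fps_expansion_unique_real:
  fixes f :: "real \<Rightarrow> real"
  assumes "f has_fps_expansion F" "f has_fps_expansion G"
  shows "F = G"
  using assms by (simp add: fps_eq_iff fps_nth_has_fps_expansion_real)

lemma has_fps_expansion_cosh_real:
  "(cosh :: real \<Rightarrow> real) has_fps_expansion fps_const (1/2) * (fps_exp 1 + fps_exp (-1))"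
proof -
  have "(\<lambda>x::real. (1/2) * (exp (1 * x) + exp ((-1) * x))) has_fps_expansion
          fps_const (1/2) * (fps_exp 1 + fps_exp (-1))"
    by (intro has_fps_expansion_cmult_left has_fps_expansion_add has_fps_expansion_exp)
  also have "(\<lambda>x::real. (1/2) * (exp (1 * x) + exp ((-1) * x))) = cosh"
    by (auto simp: cosh_def)
  finally show ?thesis .
qed

lemma fujita_gen_expansion_exists: "\<exists>F. fujita_gen t x has_fps_expansion F"
proof -
  let ?C = "fps_const (1/2) * (fps_exp 1 + fps_exp (-1)) :: real fps"
  have pow: "(\<lambda>\<alpha>::real. cosh \<alpha> ^ t) has_fps_expansion ?C ^ t"
    by (induction t) (auto intro: has_fps_expansion_mult has_fps_expansion_cosh_real)
  have "(\<lambda>\<alpha>::real. exp (real_of_int x * \<alpha>) / cosh \<alpha> ^ t) has_fps_expansion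
          (fps_exp (real_of_int x) / ?C ^ t)"
    by (rule has_fps_expansion_divide'[OF has_fps_expansion_exp pow])
       (simp add: fps_nth_power_0)
  then show ?thesis
    by (auto simp: fujita_gen_def[abs_def] mult.commute)
qed

lemma fujita_gen_has_fps_expansion:
  "fujita_gen t x has_fps_expansion Abs_fps (\<lambda>n. fujita_poly n t x / fact n)"
proof -
  obtain F where F: "fujita_gen t x has_fps_expansion F"
    using fujita_gen_expansion_exists by blast
  then have "(THE F. fujita_gen t x has_fps_expansion F) = F"
    using has_fps_expansion_unique_real by blast
  then have "Abs_fps (\<lambda>n. fujita_poly n t x / fact n) = F"
    by (simp add: fujita_poly_def fps_eq_iff)
  with F show ?thesis by simp
qed

lemma fujita_poly_expansion:
  "eventually (\<lambda>\<alpha>::real.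
     (\<lambda>n. fujita_poly n t x * \<alpha> ^ n / fact n) sums (exp (\<alpha> * x) / cosh \<alpha> ^ t)) (nhds 0)"
proof -
  let ?F = "Abs_fps (\<lambda>n. fujita_poly n t x / fact n)"
  have r: "fps_conv_radius ?F > 0"
    and ev: "eventually (\<lambda>\<alpha>. eval_fps ?F \<alpha> = fujita_gen t x \<alpha>) (nhds 0)"
    using fujita_gen_has_fps_expansion[of t x] by (auto simp: has_fps_expansion_def)
  have "eventually (\<lambda>\<alpha>::real. \<alpha> \<in> eball 0 (fps_conv_radius ?F)) (nhds 0)"
    using r by (intro eventually_nhds_in_open) (auto simp: zero_ereal_def)
  with ev show ?thesis
  proof eventually_elim
    case (elim \<alpha>)
    then have "(\<lambda>n. fps_nth ?F n * \<alpha> ^ n) sums eval_fps ?F \<alpha>"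
      by (intro sums_eval_fps) (auto simp: in_eball_iff)
    with elim show ?case by (simp add: fujita_gen_def)
  qed
qed

(* S is the sequence of partial sums of i.i.d. steps with law D. The steps are indexed from 1,
   so S 0 = 0. *)
definition iid_walk :: "'a measure \<Rightarrow> 'b::comm_monoid_add measure \<Rightarrow> (nat \<Rightarrow> 'a \<Rightarrow> 'b) \<Rightarrow> bool" where
  "iid_walk M D S \<longleftrightarrow>
     (\<exists>\<zeta>. prob_space.indep_vars M (\<lambda>_. D) \<zeta> {1::nat..} \<and>
          (\<forall>k\<ge>1. distr M D (\<zeta> k) = D) \<and>
          (\<forall>t. \<forall>\<omega>\<in>space M. S t \<omega> = (\<Sum>k=1..t. \<zeta> k \<omega>)))"

definition simple_symmetric_walk :: "'a measure \<Rightarrow> (nat \<Rightarrow> 'a \<Rightarrow> int) \<Rightarrow> bool" where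
  "simple_symmetric_walk M S \<longleftrightarrow> iid_walk M (measure_pmf (pmf_of_set {-1, 1})) S"

definition sech_distribution :: "real measure" where
  "sech_distribution = density lborel (\<lambda>x. ennreal (1 / (2 * cosh (pi * x / 2))))"

definition sech_walk :: "'a measure \<Rightarrow> (nat \<Rightarrow> 'a \<Rightarrow> real) \<Rightarrow> bool" where
  "sech_walk M S \<longleftrightarrow> iid_walk M sech_distribution S"

definition indep_processes ::
    "'a measure \<Rightarrow> (nat \<Rightarrow> 'a \<Rightarrow> int) \<Rightarrow> (nat \<Rightarrow> 'a \<Rightarrow> real) \<Rightarrow> bool" where
  "indep_processes M S S' \<longleftrightarrow>
     prob_space.indep_var M
       (PiM UNIV (\<lambda>_. count_space UNIV)) (\<lambda>\<omega> t. S t \<omega>)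
       (PiM UNIV (\<lambda>_. borel)) (\<lambda>\<omega> t. S' t \<omega>)"

definition complexification ::
    "(nat \<Rightarrow> 'a \<Rightarrow> int) \<Rightarrow> (nat \<Rightarrow> 'a \<Rightarrow> real) \<Rightarrow> nat \<Rightarrow> 'a \<Rightarrow> complex" where
  "complexification S S' t \<omega> = of_int (S t \<omega>) + \<i> * of_real (S' t \<omega>)"

(* The process S with its path kept fixed at the one realised under \<omega>. Averaging a functional of
   (frozen S \<omega>, S') over M is the expectation with respect to S' only, evaluated at \<omega>; the result
   depends on S' through its law alone, so no product structure on M is required. *)
definition frozen :: "(nat \<Rightarrow> 'a \<Rightarrow> 'b) \<Rightarrow> 'a \<Rightarrow> nat \<Rightarrow> 'a \<Rightarrow> 'b" where
  "frozen S \<omega> = (\<lambda>t _. S t \<omega>)"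

end

theory Submission
  imports Defs "HOL-Real_Asymp.Real_Asymp"
begin

text \<open>
  The substitution \<open>x = ln (t / (1 - t)) / pi\<close> turns the exponential moments of the sech density into
  a Beta integral, and Euler's reflection formula evaluates them to \<open>1 / cos \<theta>\<close> for
  \<open>\<bar>\<theta>\<bar> < pi / 2\<close>. Hence, as formal power series, the exponential moment generating series of
  \<open>S' t\<close> is the inverse of \<open>cos ^ t\<close>. Replacing \<open>\<theta>\<close> by \<open>\<i> \<alpha>\<close> formally turns \<open>cos\<close> into \<open>cosh\<close>, and
  multiplying by \<open>exp (\<alpha> x)\<close> gives Fujita's generating function; the binomial theorem identifies the
  coefficients.
\<close>

section \<open>Exponential moments of the hyperbolic secant law\<close>

text \<open>Twice the cosh is \<open>sqrt (a / b) + sqrt (b / a) = (a + b) / sqrt (a * b)\<close>,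
  and the numerator is 1. With \<open>a = t\<close> and \<open>b = 1 - t\<close> this rewrites the
  sech density after the logarithmic substitution.\<close>

lemma inverse_two_cosh_half_diff_ln:
  fixes a b :: real
  assumes "a > 0" "b > 0" "a + b = 1"
  shows "1 / (2 * cosh ((ln a - ln b) / 2)) = exp ((ln a + ln b) / 2)"
proof -
  have "2 * cosh ((ln a - ln b) / 2) * exp ((ln a + ln b) / 2) = exp (ln a) + exp (ln b)"
    by (simp add: cosh_def ring_distribs flip: exp_add) (simp add: field_simps)
  then have "2 * cosh ((ln a - ln b) / 2) * exp ((ln a + ln b) / 2) = 1"
    using assms by simp
  then show ?thesis
    by (simp add: field_simps)
qed

text \<open>The arguments add up to 1 and \<open>Gamma 1 = 1\<close>, so the Beta value is the
  product in Euler's reflection formula at \<open>1 / 2 + s\<close>. The shift by one half turns the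
  sine into a cosine.\<close>

lemma Beta_half_plus_half_minus:
  fixes s :: real
  assumes "\<bar>s\<bar> < 1 / 2"
  shows "Beta (1 / 2 + s) (1 / 2 - s) = pi / cos (pi * s)"
proof -
  let ?z = "1 / 2 + s"
  have "complex_of_real (Gamma ?z * Gamma (1 - ?z)) = Gamma (of_real ?z) * Gamma (1 - of_real ?z)"
    unfolding of_real_mult Gamma_complex_of_real[symmetric] of_real_diff of_real_1 ..
  also have "\<dots> = of_real (pi / sin (pi * ?z))"
    unfolding Gamma_reflection_complex of_real_divide sin_of_real[symmetric] of_real_mult ..
  finally have "complex_of_real (Gamma ?z * Gamma (1 - ?z)) = of_real (pi / sin (pi * ?z))" .
  then have "Gamma ?z * Gamma (1 - ?z) = pi / sin (pi * ?z)"
    using of_real_eq_iff by blast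
  moreover have "sin (pi * ?z) = cos (pi * s)"
    by (simp add: distrib_left sin_add)
  ultimately show ?thesis
    by (simp add: Beta_def)
qed

lemma sech_density_exp_moment:
  fixes \<theta> :: real
  assumes "\<bar>\<theta>\<bar> < pi / 2"
  shows "has_bochner_integral lborel (\<lambda>x. 1 / (2 * cosh (pi * x / 2)) * exp (\<theta> * x)) (1 / cos \<theta>)"
proof -
  \<comment> \<open>The transformed density contributes \<open>t\<close> and \<open>1 - t\<close> to
    the power 1/2 each, the factor \<open>exp (\<theta> * g t)\<close> contributes the powers
    \<open>\<theta> / pi\<close> and \<open>- \<theta> / pi\<close>, and \<open>g'\<close> the power
    -1 of both; the totals are \<open>a - 1\<close> and \<open>b - 1\<close>. The bound on
    \<open>\<theta>\<close> says exactly that \<open>a\<close> and \<open>b\<close> are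
    positive.\<close>
  define a where "a = 1 / 2 + \<theta> / pi"
  define b where "b = 1 / 2 - \<theta> / pi"
  define f where "f = (\<lambda>x. 1 / (2 * cosh (pi * x / 2)) * exp (\<theta> * x))"
  define g where "g = (\<lambda>t::real. (ln t - ln (1 - t)) / pi)"
  define g' where "g' = (\<lambda>t::real. 1 / (pi * t * (1 - t)))"
  have s: "\<bar>\<theta> / pi\<bar> < 1 / 2"
    using assms by (simp add: abs_divide divide_simps)
  then have ab: "a > 0" "b > 0"
    unfolding a_def b_def by linarith+
  have fg: "f (g t) * g' t = t powr (a - 1) * (1 - t) powr (b - 1) / pi" if "0 < t" "t < 1" for t
  proof -
    have "f (g t) = exp ((ln t + ln (1 - t)) / 2) * exp (\<theta> / pi * (ln t - ln (1 - t)))"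
      using that by (simp add: f_def g_def flip: inverse_two_cosh_half_diff_ln)
    moreover have "g' t = exp (- ln t) * exp (- ln (1 - t)) / pi"
      using that by (simp add: g'_def exp_minus field_simps)
    ultimately have "f (g t) * g' t = exp ((ln t + ln (1 - t)) / 2 +
        \<theta> / pi * (ln t - ln (1 - t)) + - ln t + - ln (1 - t)) / pi"
      by (simp only: exp_add times_divide_eq_right mult.assoc)
    also have "(ln t + ln (1 - t)) / 2 + \<theta> / pi * (ln t - ln (1 - t)) + - ln t + - ln (1 - t)
        = (a - 1) * ln t + (b - 1) * ln (1 - t)"
      by (simp add: a_def b_def field_simps)
    finally show ?thesis
      using that by (simp add: powr_def exp_add)
  qed
  have "((\<lambda>t. t powr (a - 1) * (1 - t) powr (b - 1)) has_integral Beta a b) {0<..<1}"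
    using has_integral_Beta_real[OF ab] by (simp add: has_integral_Icc_iff_Ioo)
  from has_integral_divide[OF this, of pi]
  have hk: "((\<lambda>t. f (g t) * g' t) has_integral Beta a b / pi) {0<..<1}"
    by (rule has_integral_eq[rotated]) (simp add: fg)
  have nonneg: "0 \<le> f (g t) * g' t" if "t \<in> {0<..<1}" for t
    using that by (simp add: fg)
  have meas: "(\<lambda>t. f (g t) * g' t) \<in> borel_measurable borel"
    unfolding f_def g_def g'_def by (simp add: cosh_def) measurable
  \<comment> \<open>Nonnegativity upgrades the gauge integral of the Beta integrand to a Lebesgue
    integral; Borel measurability then allows passing from the completed measure to
    \<open>lborel\<close>.\<close>
  have "(\<lambda>t. f (g t) * g' t) absolutely_integrable_on {0<..<1}"
    using hk nonneg by (intro nonnegative_absolutely_integrable_1) auto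
  then have int: "set_integrable lborel (einterval (ereal 0) (ereal 1)) (\<lambda>t. f (g t) * g' t)"
    unfolding set_integrable_def einterval_eq
    by (subst (asm) integrable_completion) (use meas in measurable)
  have lims: "((ereal \<circ> g \<circ> real_of_ereal) \<longlongrightarrow> -\<infinity>) (at_right (ereal 0))"
    "((ereal \<circ> g \<circ> real_of_ereal) \<longlongrightarrow> \<infinity>) (at_left (ereal 1))"
    unfolding ereal_tendsto_simps g_def by real_asymp+
  have D: "DERIV g t :> g' t" if "0 < t" "t < 1" for t
    unfolding g_def g'_def using that
    by (auto intro!: derivative_eq_intros simp: divide_simps)
  have contf: "isCont f x" for x
    unfolding f_def by (intro continuous_intros) simp_all
  have contg': "isCont g' t" if "0 < t" "t < 1" for t
    unfolding g'_def using that by (intro continuous_intros) simp_all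
  have f0: "0 \<le> f x" for x
    by (simp add: f_def)
  \<comment> \<open>At the endpoints \<open>g'\<close> is a division by zero, hence 0, so the sign
    condition holds on the closed interval.\<close>
  have g'0: "0 \<le> g' t" if "0 \<le> t" "t \<le> 1" for t
    using that by (simp add: g'_def)
  \<comment> \<open>For a nonnegative integrand the substitution rule also yields integrability of
    \<open>f\<close> on the whole line from that of the transformed integrand.\<close>
  have subst: "set_integrable lborel (einterval (-\<infinity>) \<infinity>) f"
    "(LBINT x=-\<infinity>..\<infinity>. f x) = (LBINT t=ereal 0..ereal 1. f (g t) * g' t)"
    by (rule interval_integral_substitution_nonneg[where f = f and g = g and g' = g'
          and a = "ereal 0" and b = "ereal 1" and A = "-\<infinity>" and B = \<infinity>];
        use D contf contg' f0 g'0 lims int in simp)+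
  have "set_integrable lborel UNIV f"
    using subst(1) by simp
  then have "integrable lborel f"
    by (simp add: set_integrable_def)
  moreover have "(LBINT x=-\<infinity>..\<infinity>. f x) = Beta a b / pi"
  proof -
    have "(LBINT x=-\<infinity>..\<infinity>. f x) = (LBINT t=ereal 0..ereal 1. f (g t) * g' t)"
      using subst(2) by simp
    also have "\<dots> = integral {0<..<1} (\<lambda>t. f (g t) * g' t)"
      using int by (subst interval_integral_eq_integral') auto
    finally show ?thesis
      using hk by (simp add: integral_unique)
  qed
  then have "integral\<^sup>L lborel f = 1 / cos \<theta>"
    using Beta_half_plus_half_minus[OF s]
    by (simp add: interval_lebesgue_integral_def set_lebesgue_integral_def a_def b_def)
  ultimately show ?thesis
    by (simp add: has_bochner_integral_iff f_def)
qed

lemma has_bochner_integral_exp_sech_distribution: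
  assumes "\<bar>\<theta>\<bar> < pi / 2"
  shows "has_bochner_integral sech_distribution (\<lambda>x. exp (\<theta> * x)) (1 / cos \<theta>)"
  unfolding sech_distribution_def
  using sech_density_exp_moment[OF assms]
  by (intro has_bochner_integral_density) (auto simp: cosh_def)

section \<open>Exponential moments of the walk\<close>

text \<open>The exponential of the sum is a product of \<open>t\<close> independent factors, each
  with expectation \<open>1 / cos \<theta>\<close>, and expectations of independent factors
  multiply.\<close>

lemma (in prob_space) sech_walk_exp_moment:
  assumes "sech_walk M X" and \<theta>: "\<bar>\<theta>\<bar> < pi / 2"
  shows "has_bochner_integral M (\<lambda>\<omega>. exp (\<theta> * X t \<omega>)) (1 / cos \<theta> ^ t)"
proof -
  obtain \<zeta> where ind: "indep_vars (\<lambda>_. sech_distribution) \<zeta> {1::nat..}"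
    and distr: "\<And>k. k \<ge> 1 \<Longrightarrow> distr M sech_distribution (\<zeta> k) = sech_distribution"
    and X: "\<And>t \<omega>. \<omega> \<in> space M \<Longrightarrow> X t \<omega> = (\<Sum>k=1..t. \<zeta> k \<omega>)"
    using assms unfolding sech_walk_def iid_walk_def by blast
  have [measurable_cong]: "sets sech_distribution = sets borel"
    by (simp add: sech_distribution_def)
  have rv: "\<zeta> k \<in> measurable M sech_distribution" if "k \<ge> 1" for k
    using ind that by (auto simp: indep_vars_def)
  have step: "has_bochner_integral M (\<lambda>\<omega>. exp (\<theta> * \<zeta> k \<omega>)) (1 / cos \<theta>)" if "k \<ge> 1" for k
    using has_bochner_integral_exp_sech_distribution[OF \<theta>] rv[OF that] distr[OF that]
      integrable_distr_eq[of "\<zeta> k" M sech_distribution "\<lambda>x. exp (\<theta> * x)"]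
      integral_distr[of "\<zeta> k" M sech_distribution "\<lambda>x. exp (\<theta> * x)"]
    by (simp add: has_bochner_integral_iff)
  have ind': "indep_vars (\<lambda>_. borel) (\<lambda>k \<omega>. exp (\<theta> * \<zeta> k \<omega>)) {1..t}"
    by (rule indep_vars_compose2[OF indep_vars_subset[OF ind]]) auto
  have "has_bochner_integral M (\<lambda>\<omega>. \<Prod>k=1..t. exp (\<theta> * \<zeta> k \<omega>)) (1 / cos \<theta> ^ t)"
    using indep_vars_integrable[OF _ ind'] indep_vars_lebesgue_integral[OF _ ind'] step
    by (simp add: has_bochner_integral_iff power_one_over)
  \<comment> \<open>\<open>X t\<close> is known to be the sum of the steps only on
    \<open>space M\<close>, hence the congruence.\<close>
  then show ?thesis
    by (rule has_bochner_integral_cong[THEN iffD1, rotated -1])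
       (simp_all add: X sum_distrib_left exp_sum)
qed

lemma (in prob_space) sech_walk_measurable:
  assumes "sech_walk M X"
  shows "X t \<in> borel_measurable M"
proof -
  obtain \<zeta> where ind: "indep_vars (\<lambda>_. sech_distribution) \<zeta> {1::nat..}"
    and X: "\<And>t \<omega>. \<omega> \<in> space M \<Longrightarrow> X t \<omega> = (\<Sum>k=1..t. \<zeta> k \<omega>)"
    using assms unfolding sech_walk_def iid_walk_def by blast
  have [measurable_cong]: "sets sech_distribution = sets borel"
    by (simp add: sech_distribution_def)
  have "\<zeta> k \<in> borel_measurable M" if "k \<ge> 1" for k
    using ind that measurable_cong_sets[OF refl \<open>sets sech_distribution = sets borel\<close>]
    by (auto simp: indep_vars_def)
  then show ?thesis
    by (subst measurable_cong[OF X]) auto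
qed

section \<open>Power series of moments\<close>

lemma power_over_fact_le_exp: "x ^ n / fact n \<le> exp x" if "0 \<le> x" for x :: real
proof -
  have "x ^ n /\<^sub>R fact n \<le> (\<Sum>k. x ^ k /\<^sub>R fact k)"
    using that by (intro sum_le_suminf[of _ "{n}", simplified] summable_exp_generic) auto
  then show ?thesis
    by (simp add: exp_def divide_inverse mult.commute)
qed

text \<open>A single term of the exponential series at \<open>r * \<bar>X \<omega>\<bar>\<close>
  yields an integrable majorant of the power.\<close>

lemma integrable_power_if_integrable_exp:
  fixes X :: "'a \<Rightarrow> real"
  assumes [measurable]: "X \<in> borel_measurable M" and r: "r > 0"
    and int: "integrable M (\<lambda>\<omega>. exp (r * \<bar>X \<omega>\<bar>))"
  shows "integrable M (\<lambda>\<omega>. X \<omega> ^ n)"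
proof (rule Bochner_Integration.integrable_bound)
  show "integrable M (\<lambda>\<omega>. fact n / r ^ n * exp (r * \<bar>X \<omega>\<bar>))"
    using int by simp
  show "AE \<omega> in M. norm (X \<omega> ^ n) \<le> norm (fact n / r ^ n * exp (r * \<bar>X \<omega>\<bar>))"
    using power_over_fact_le_exp[of "r * \<bar>X _\<bar>" n] r
    by (intro AE_I2) (simp add: power_mult_distrib power_abs field_simps)
qed simp

text \<open>The exponential series is integrated term by term, with
  \<open>exp (r * \<bar>X \<omega>\<bar>)\<close> dominating all partial sums of absolute values.
  The endpoint \<open>\<theta> = r\<close> is included in order to bound the radius of convergence
  from below.\<close>

lemma exp_moment_sums:
  fixes X :: "'a \<Rightarrow> real"
  assumes meas [measurable]: "X \<in> borel_measurable M" and r: "r > 0"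
    and int: "integrable M (\<lambda>\<omega>. exp (r * \<bar>X \<omega>\<bar>))" and \<theta>: "\<bar>\<theta>\<bar> \<le> r"
  shows "(\<lambda>n. (\<integral>\<omega>. X \<omega> ^ n \<partial>M) / fact n * \<theta> ^ n) sums (\<integral>\<omega>. exp (\<theta> * X \<omega>) \<partial>M)"
proof -
  define f where "f n \<omega> = (\<theta> * X \<omega>) ^ n /\<^sub>R fact n" for n \<omega>
  have f_int: "integrable M (f n)" for n
    unfolding f_def power_mult_distrib
    using integrable_power_if_integrable_exp[OF meas r int] by simp
  have f_norm: "norm (f n \<omega>) = \<bar>\<theta> * X \<omega>\<bar> ^ n /\<^sub>R fact n" for n \<omega>
    by (simp add: f_def abs_mult power_abs)
  have abs_sum: "summable (\<lambda>n. norm (f n \<omega>))" for \<omega>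
    unfolding f_norm by (rule summable_exp_generic)
  have "summable (\<lambda>n. \<integral>\<omega>. norm (f n \<omega>) \<partial>M)"
  proof (rule summableI_nonneg_bounded)
    fix N
    have "(\<Sum>n<N. \<integral>\<omega>. norm (f n \<omega>) \<partial>M) = (\<integral>\<omega>. (\<Sum>n<N. norm (f n \<omega>)) \<partial>M)"
      using f_int by simp
    also have "\<dots> \<le> (\<integral>\<omega>. exp (r * \<bar>X \<omega>\<bar>) \<partial>M)"
    proof (intro integral_mono int Bochner_Integration.integrable_sum integrable_norm f_int)
      fix \<omega>
      have "(\<Sum>n<N. norm (f n \<omega>)) \<le> (\<Sum>n. norm (f n \<omega>))"
        by (intro sum_le_suminf abs_sum) auto
      also have "\<dots> = exp \<bar>\<theta> * X \<omega>\<bar>"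
        unfolding f_norm exp_def ..
      also have "\<dots> \<le> exp (r * \<bar>X \<omega>\<bar>)"
        using \<theta> by (simp add: abs_mult mult_right_mono)
      finally show "(\<Sum>n<N. norm (f n \<omega>)) \<le> exp (r * \<bar>X \<omega>\<bar>)" .
    qed
    finally show "(\<Sum>n<N. \<integral>\<omega>. norm (f n \<omega>) \<partial>M) \<le> (\<integral>\<omega>. exp (r * \<bar>X \<omega>\<bar>) \<partial>M)" .
  qed simp
  then have "(\<lambda>n. integral\<^sup>L M (f n)) sums (\<integral>\<omega>. (\<Sum>n. f n \<omega>) \<partial>M)"
    by (intro sums_integral f_int abs_sum AE_I2)
  moreover have "integral\<^sup>L M (f n) = (\<integral>\<omega>. X \<omega> ^ n \<partial>M) / fact n * \<theta> ^ n" for n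
    by (simp add: f_def[abs_def] power_mult_distrib divide_inverse mult_ac)
  ultimately show ?thesis
    by (simp add: f_def exp_def)
qed

lemma exp_moment_has_fps_expansion:
  fixes X :: "'a \<Rightarrow> real"
  assumes "X \<in> borel_measurable M" "r > 0" "integrable M (\<lambda>\<omega>. exp (r * \<bar>X \<omega>\<bar>))"
  shows "(\<lambda>\<theta>. \<integral>\<omega>. exp (\<theta> * X \<omega>) \<partial>M) has_fps_expansion
    Abs_fps (\<lambda>n. (\<integral>\<omega>. X \<omega> ^ n \<partial>M) / fact n)"
  unfolding has_fps_expansion_def
proof
  let ?F = "Abs_fps (\<lambda>n. (\<integral>\<omega>. X \<omega> ^ n \<partial>M) / fact n)"
  note sums = exp_moment_sums[OF assms]
  have "ereal (norm r) \<le> fps_conv_radius ?F"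
    unfolding fps_conv_radius_def
    using sums[of r] \<open>r > 0\<close> by (intro conv_radius_geI) (auto simp: sums_iff)
  then show "0 < fps_conv_radius ?F"
    using \<open>r > 0\<close> by (auto intro: less_le_trans[rotated] simp: zero_ereal_def)
  have "eventually (\<lambda>\<theta>. \<theta> \<in> {-r<..<r}) (nhds 0)"
    using \<open>r > 0\<close> by (intro eventually_nhds_in_open) auto
  then show "\<forall>\<^sub>F \<theta> in nhds 0. eval_fps ?F \<theta> = (\<integral>\<omega>. exp (\<theta> * X \<omega>) \<partial>M)"
  proof eventually_elim
    case (elim \<theta>)
    then show ?case
      using sums[of \<theta>] by (simp add: eval_fps_def sums_iff abs_le_iff)
  qed
qed

text \<open>The moment series inverts the series of \<open>cos ^ t\<close>. The product form lets
  the relation be carried over to complex coefficients by ring operations alone.\<close>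

lemma (in prob_space) sech_walk_moment_fps:
  assumes X: "sech_walk M X"
  shows "Abs_fps (\<lambda>n. (\<integral>\<omega>. X t \<omega> ^ n \<partial>M) / fact n) * fps_cos 1 ^ t = 1" (is "?F * _ = _")
    and "integrable M (\<lambda>\<omega>. X t \<omega> ^ n)"
proof -
  note mgf = sech_walk_exp_moment[OF X]
  note meas [measurable] = sech_walk_measurable[OF X, of t]
  \<comment> \<open>The radius 1 is admissible because \<open>1 < pi / 2\<close>; the exponential
    moments at 1 and -1 together dominate that of the absolute value.\<close>
  have int: "integrable M (\<lambda>\<omega>. exp (1 * \<bar>X t \<omega>\<bar>))"
  proof (rule Bochner_Integration.integrable_bound)
    show "integrable M (\<lambda>\<omega>. exp (1 * X t \<omega>) + exp (-1 * X t \<omega>))"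
      using mgf[of 1 t] mgf[of "-1" t] pi_gt3
      by (intro Bochner_Integration.integrable_add) (auto simp: has_bochner_integral_iff)
    show "AE \<omega> in M. norm (exp (1 * \<bar>X t \<omega>\<bar>)) \<le> norm (exp (1 * X t \<omega>) + exp (-1 * X t \<omega>))"
    proof (intro AE_I2)
      fix \<omega>
      have "exp \<bar>X t \<omega>\<bar> \<le> exp (X t \<omega>) + exp (- X t \<omega>)"
        by (cases "X t \<omega> \<ge> 0") simp_all
      then show "norm (exp (1 * \<bar>X t \<omega>\<bar>)) \<le> norm (exp (1 * X t \<omega>) + exp (-1 * X t \<omega>))"
        by simp
    qed
  qed measurable
  show "integrable M (\<lambda>\<omega>. X t \<omega> ^ n)"
    by (rule integrable_power_if_integrable_exp[OF meas _ int]) simp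
  have cos_pow: "(\<lambda>\<theta>::real. cos \<theta> ^ t) has_fps_expansion fps_cos 1 ^ t"
    by (induction t) (auto intro: has_fps_expansion_mult has_fps_expansion_cos')
  have "(\<lambda>\<theta>. (\<integral>\<omega>. exp (\<theta> * X t \<omega>) \<partial>M) * cos \<theta> ^ t) has_fps_expansion ?F * fps_cos 1 ^ t"
    by (intro has_fps_expansion_mult cos_pow exp_moment_has_fps_expansion[OF meas _ int]) simp
  moreover have "eventually (\<lambda>\<theta>::real. \<theta> \<in> {-pi/2<..<pi/2}) (nhds 0)"
    by (intro eventually_nhds_in_open) auto
  then have "\<forall>\<^sub>F \<theta> in nhds 0. (\<integral>\<omega>. exp (\<theta> * X t \<omega>) \<partial>M) * cos \<theta> ^ t = 1"
  proof eventually_elim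
    case (elim \<theta>)
    then have "cos \<theta> > 0" and "\<bar>\<theta>\<bar> < pi / 2"
      by (auto intro: cos_gt_zero_pi)
    then show ?case
      using mgf[of \<theta> t] by (simp add: has_bochner_integral_iff)
  qed
  \<comment> \<open>An expansion depends only on the values near 0, where the product is the
    constant 1.\<close>
  ultimately have "(\<lambda>_. 1) has_fps_expansion ?F * fps_cos 1 ^ t"
    by (auto simp: has_fps_expansion_def elim: eventually_elim2)
  then show "?F * fps_cos 1 ^ t = 1"
    by (rule has_fps_expansion_unique_real) simp
qed

section \<open>Formal substitution of an imaginary variable\<close>

text \<open>This is the substitution of \<open>c * \<alpha>\<close> for the variable
  \<open>\<alpha>\<close>: \<open>c = 1\<close> merely embeds real series into complex ones, and
  \<open>c = \<i>\<close> rotates the variable. No analytic continuation of the moment generating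
  function is involved.\<close>

definition fps_scale_complex :: "complex \<Rightarrow> real fps \<Rightarrow> complex fps" where
  "fps_scale_complex c F = Abs_fps (\<lambda>n. c ^ n * of_real (fps_nth F n))"

lemma fps_scale_complex_1 [simp]: "fps_scale_complex c 1 = 1"
  by (simp add: fps_scale_complex_def fps_eq_iff)

text \<open>In each term of the Cauchy product \<open>c ^ n\<close> splits as
  \<open>c ^ i * c ^ (n - i)\<close>. Identities between products of real series can therefore be
  transported.\<close>

lemma fps_scale_complex_mult:
  "fps_scale_complex c (F * G) = fps_scale_complex c F * fps_scale_complex c G"
proof (rule fps_ext)
  fix n
  have "c ^ n * of_real (fps_nth F i * fps_nth G (n - i)) =
      (c ^ i * of_real (fps_nth F i)) * (c ^ (n - i) * of_real (fps_nth G (n - i)))"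
    if "i \<le> n" for i
    using that by (simp flip: power_add)
  then show "fps_nth (fps_scale_complex c (F * G)) n =
      fps_nth (fps_scale_complex c F * fps_scale_complex c G) n"
    by (simp add: fps_scale_complex_def fps_mult_nth sum_distrib_left del: of_real_mult)
qed

lemma fps_scale_complex_power: "fps_scale_complex c (F ^ n) = fps_scale_complex c F ^ n"
  by (induction n) (simp_all add: fps_scale_complex_mult)

lemma fps_scale_complex_cos:
  "fps_scale_complex \<i> (fps_cos 1) =
    fps_scale_complex 1 (fps_const (1/2) * (fps_exp 1 + fps_exp (-1)))"
proof (rule fps_ext)
  fix n
  \<comment> \<open>For even \<open>n\<close> the expression is a power of
    \<open>\<i> ^ 2 * (-1) = 1\<close>, which removes the alternating signs of the cosine; odd
    coefficients vanish on both sides.\<close>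
  have "\<i> ^ n * (-1) ^ (n div 2) = (1::complex)" if "even n"
    using that by (auto elim!: evenE simp: power_mult simp flip: power_mult_distrib)
  then show "fps_nth (fps_scale_complex \<i> (fps_cos 1)) n =
      fps_nth (fps_scale_complex 1 (fps_const (1/2) * (fps_exp 1 + fps_exp (-1)))) n"
    by (auto simp: fps_scale_complex_def fps_cos_def fps_exp_def divide_simps)
qed

section \<open>Fujita's polynomials as moments\<close>

lemma fujita_poly_fps:
  "Abs_fps (\<lambda>n. fujita_poly n t x / fact n) * (fps_const (1/2) * (fps_exp 1 + fps_exp (-1))) ^ t
    = fps_exp (real_of_int x)" (is "?F * ?C ^ t = _")
proof -
  have cosh_pow: "(\<lambda>\<alpha>::real. cosh \<alpha> ^ t) has_fps_expansion ?C ^ t"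
    by (induction t) (auto intro: has_fps_expansion_mult has_fps_expansion_cosh_real)
  have "(\<lambda>\<alpha>. fujita_gen t x \<alpha> * cosh \<alpha> ^ t) has_fps_expansion ?F * ?C ^ t"
    by (intro has_fps_expansion_mult cosh_pow fujita_gen_has_fps_expansion)
  moreover have "(\<lambda>\<alpha>. fujita_gen t x \<alpha> * cosh \<alpha> ^ t) = (\<lambda>\<alpha>. exp (real_of_int x * \<alpha>))"
    by (simp add: fujita_gen_def fun_eq_iff mult.commute)
  ultimately show ?thesis
    using has_fps_expansion_unique_real has_fps_expansion_exp by metis
qed

text \<open>Both Fujita's series and the rotated moment series are governed by the same factor
  \<open>K\<close>, the series of \<open>cosh ^ t\<close>. Since the rotated moment series is an
  inverse of \<open>K\<close>, it can replace division by \<open>cosh ^ t\<close>, and comparing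
  coefficients gives a binomial sum.\<close>

lemma (in prob_space) fujita_poly_eq_moment_sum:
  assumes "sech_walk M X"
  shows "complex_of_real (fujita_poly n t x) =
    (\<Sum>k\<le>n. of_nat (n choose k) * (\<i> ^ k * of_real (\<integral>\<omega>. X t \<omega> ^ k \<partial>M)) * of_int x ^ (n - k))"
proof -
  let ?C = "fps_const (1/2) * (fps_exp 1 + fps_exp (-1)) :: real fps"
  define F where "F = Abs_fps (\<lambda>n. fujita_poly n t x / fact n)"
  define G where "G = Abs_fps (\<lambda>n. (\<integral>\<omega>. X t \<omega> ^ n \<partial>M) / fact n)"
  define K where "K = fps_scale_complex 1 ?C ^ t"
  have F: "fps_scale_complex 1 F * K = fps_scale_complex 1 (fps_exp (real_of_int x))"
    unfolding K_def F_def fujita_poly_fps[of t x, symmetric]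
    by (simp only: fps_scale_complex_mult fps_scale_complex_power)
  have "fps_scale_complex \<i> (G * fps_cos 1 ^ t) = 1"
    using sech_walk_moment_fps(1)[OF assms, of t] by (simp add: G_def)
  then have G: "fps_scale_complex \<i> G * K = 1"
    by (simp only: fps_scale_complex_mult fps_scale_complex_power fps_scale_complex_cos K_def)
  have "fps_scale_complex 1 F = fps_scale_complex 1 F * (fps_scale_complex \<i> G * K)"
    by (simp add: G)
  also have "\<dots> = fps_scale_complex \<i> G * fps_scale_complex 1 (fps_exp (real_of_int x))"
    unfolding F[symmetric] by (simp only: mult_ac)
  finally have "fps_nth (fps_scale_complex 1 F) n = (\<Sum>k\<le>n. (\<i> ^ k * of_real ((\<integral>\<omega>. X t \<omega> ^ k \<partial>M) / fact k)) *
      (of_int x ^ (n - k) / fact (n - k)))"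
    by (simp add: fps_scale_complex_def fps_mult_nth G_def fps_exp_def atLeast0AtMost)
  then have "complex_of_real (fujita_poly n t x) = fact n * (\<Sum>k\<le>n. (\<i> ^ k * of_real ((\<integral>\<omega>. X t \<omega> ^ k \<partial>M) / fact k)) *
      (of_int x ^ (n - k) / fact (n - k)))"
    by (simp add: fps_scale_complex_def F_def field_simps)
  also have "\<dots> = (\<Sum>k\<le>n. of_nat (n choose k) * (\<i> ^ k * of_real (\<integral>\<omega>. X t \<omega> ^ k \<partial>M)) * of_int x ^ (n - k))"
    unfolding sum_distrib_left
    by (intro sum.cong) (auto simp: binomial_fact field_simps)
  finally show ?thesis .
qed

theorem lemma2p2:
  fixes M :: "'a measure"
    and S :: "nat \<Rightarrow> 'a \<Rightarrow> int"
    and S' :: "nat \<Rightarrow> 'a \<Rightarrow> real"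
  assumes "prob_space M"
    and "simple_symmetric_walk M S"
    and "sech_walk M S'"
    and "indep_processes M S S'"
  shows "\<forall>n t. \<forall>\<omega>\<in>space M.
           integrable M (\<lambda>\<omega>'. complexification (frozen S \<omega>) S' t \<omega>' ^ n) \<and>
           complex_of_real (fujita_poly n t (S t \<omega>)) =
             (LINT \<omega>'|M. complexification (frozen S \<omega>) S' t \<omega>' ^ n)"
proof (intro allI ballI)
  fix n t \<omega>
  interpret prob_space M by fact
  let ?x = "S t \<omega>"
  \<comment> \<open>With the path of \<open>S\<close> frozen, \<open>?x\<close> is constant in
    \<open>\<omega>'\<close>, so the binomial theorem leaves only powers of \<open>S' t\<close> to
    be integrated.\<close>
  have expand: "complexification (frozen S \<omega>) S' t \<omega>' ^ n =
      (\<Sum>k\<le>n. of_nat (n choose k) * (\<i> ^ k * of_real (S' t \<omega>' ^ k)) * of_int ?x ^ (n - k))" for \<omega>'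
    using binomial_ring[of "\<i> * of_real (S' t \<omega>')" "complex_of_int ?x" n]
    by (simp add: complexification_def frozen_def add.commute power_mult_distrib)
  have int: "integrable M (\<lambda>\<omega>'. complex_of_real (S' t \<omega>' ^ k))" for k
    using sech_walk_moment_fps(2)[OF assms(3)] by (intro integrable_of_real)
  show "integrable M (\<lambda>\<omega>'. complexification (frozen S \<omega>) S' t \<omega>' ^ n) \<and>
      complex_of_real (fujita_poly n t ?x) = (LINT \<omega>'|M. complexification (frozen S \<omega>) S' t \<omega>' ^ n)"
    unfolding expand fujita_poly_eq_moment_sum[OF assms(3)]
    using int by (simp del: of_real_power)
qed

end
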